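(* The Polish group $\mathrm{Isom}(\mathbf{H})$ has no dense conjugacy class.
   Context: $\mathcal{H}$ is an infinite-dimensional separable real Hilbert space with Hilbert basis $(e_i)_{i\in\mathbb{N}}$, and $Q(x)=x_0^2-\sum_{i\ge1}x_i^2$ with polarized symmetric bilinear form $(\cdot,\cdot)$. The infinite-dimensional separable hyperbolic space is $\mathbf{H}=\{x\in\mathcal{H}: Q(x)=1,\ x_0>0\}$ with metric $\cosh d(x,y)=(x,y)$. $\mathrm{Isom}(\mathbf{H})$ is its isometry group with the topology of pointwise convergence (the coarsest group topology making all orbit maps $g\mapsto gx$, $x\in\mathbf{H}$, continuous), which is Polish. *)

theory Defs
  imports "HOL-Analysis.Analysis" "HOL-Algebra.Bij"
begin

section \<open>The infinite-dimensional hyperbolic space\<close>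

definition hilbert_basis :: "(nat \<Rightarrow> 'a::{real_inner,complete_space}) \<Rightarrow> bool" where
  "hilbert_basis e \<longleftrightarrow>
     (\<forall>i j. e i \<bullet> e j = (if i = j then 1 else 0)) \<and> closure (span (range e)) = UNIV"

definition lorentz_Q :: "(nat \<Rightarrow> 'a::{real_inner,complete_space}) \<Rightarrow> 'a \<Rightarrow> real" where
  "lorentz_Q e x = (x \<bullet> e 0)\<^sup>2 - (\<Sum>i. (x \<bullet> e (Suc i))\<^sup>2)"

definition lorentz_form :: "(nat \<Rightarrow> 'a::{real_inner,complete_space}) \<Rightarrow> 'a \<Rightarrow> 'a \<Rightarrow> real" where
  "lorentz_form e x y = (lorentz_Q e (x + y) - lorentz_Q e x - lorentz_Q e y) / 2"

definition hyp_space :: "(nat \<Rightarrow> 'a::{real_inner,complete_space}) \<Rightarrow> 'a set" where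
  "hyp_space e = {x. lorentz_Q e x = 1 \<and> x \<bullet> e 0 > 0}"

text \<open>The value \<open>0\<close> off the space is a dummy, needed because \<^locale>\<open>Metric_space\<close> requires
  nonnegativity of the distance on the whole type.\<close>

definition hyp_dist :: "(nat \<Rightarrow> 'a::{real_inner,complete_space}) \<Rightarrow> 'a \<Rightarrow> 'a \<Rightarrow> real" where
  "hyp_dist e x y =
     (if x \<in> hyp_space e \<and> y \<in> hyp_space e then arcosh (lorentz_form e x y) else 0)"

section \<open>Its isometry group\<close>

text \<open>As in \<^const>\<open>BijGroup\<close>, a self-map of the space is represented by the function on the
  ambient type that is \<^const>\<open>undefined\<close> outside the space.\<close>

definition hyp_isometries :: "(nat \<Rightarrow> 'a::{real_inner,complete_space}) \<Rightarrow> ('a \<Rightarrow> 'a) set" where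
  "hyp_isometries e = {g \<in> Bij (hyp_space e).
     \<forall>x\<in>hyp_space e. \<forall>y\<in>hyp_space e. hyp_dist e (g x) (g y) = hyp_dist e x y}"

definition Isom :: "(nat \<Rightarrow> 'a::{real_inner,complete_space}) \<Rightarrow> ('a \<Rightarrow> 'a) monoid" where
  "Isom e = BijGroup (hyp_space e) \<lparr>carrier := hyp_isometries e\<rparr>"

text \<open>The topology of pointwise convergence is the one induced by the product topology on the
  self-maps of the space, each factor carrying the topology of the hyperbolic metric.\<close>

definition Isom_topology ::
    "(nat \<Rightarrow> 'a::{real_inner,complete_space}) \<Rightarrow> ('a \<Rightarrow> 'a) topology" where
  "Isom_topology e = subtopology
     (product_topology (\<lambda>_. Metric_space.mtopology (hyp_space e) (hyp_dist e)) (hyp_space e))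
     (carrier (Isom e))"

definition conjugacy_class :: "('g, 'm) monoid_scheme \<Rightarrow> 'g \<Rightarrow> 'g set" where
  "conjugacy_class G g = {h \<otimes>\<^bsub>G\<^esub> g \<otimes>\<^bsub>G\<^esub> inv\<^bsub>G\<^esub> h | h. h \<in> carrier G}"

section \<open>Basic facts: the distance is a metric and the isometries form a group\<close>

context
  fixes e :: "nat \<Rightarrow> 'a::{real_inner,complete_space}"
  assumes hb: "hilbert_basis e"
begin

lemma hilbert_basis_inner: "e i \<bullet> e j = (if i = j then 1 else 0)"
  using hb by (simp add: hilbert_basis_def)

lemma hilbert_basis_parseval: "(\<lambda>n. (x \<bullet> e n)\<^sup>2) sums (x \<bullet> x)"
proof -
  define P where "P N x = (\<Sum>n<N. (x \<bullet> e n) *\<^sub>R e n)" for N x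
  have Pe: "P N x \<bullet> e n = (if n < N then x \<bullet> e n else 0)" for N x n
    by (simp add: P_def inner_sum_left hilbert_basis_inner sum.delta if_distrib cong: if_cong)
  have Pn: "P N x \<bullet> P N x = (\<Sum>n<N. (x \<bullet> e n)\<^sup>2)" for N x
  proof -
    have "P N x \<bullet> P N x = (\<Sum>n<N. (x \<bullet> e n) * (P N x \<bullet> e n))"
      by (subst (2) P_def) (simp add: inner_sum_right)
    then show ?thesis by (simp add: Pe power2_eq_square)
  qed
  have xP: "x \<bullet> P N x = (\<Sum>n<N. (x \<bullet> e n)\<^sup>2)" for N x
    by (simp add: P_def inner_sum_right power2_eq_square)
  have res: "(norm (x - P N x))\<^sup>2 = x \<bullet> x - (\<Sum>n<N. (x \<bullet> e n)\<^sup>2)" for N x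
    unfolding power2_norm_eq_inner
    using Pn[of N x] xP[of x N] by (simp add: inner_diff_left inner_diff_right inner_commute)
  have contr: "norm (x - P N x) \<le> norm x" for N x
  proof (rule power2_le_imp_le)
    show "(norm (x - P N x))\<^sup>2 \<le> (norm x)\<^sup>2"
      unfolding res power2_norm_eq_inner[of x] by (simp add: sum_nonneg)
  qed simp
  have Padd: "P N (x + y) = P N x + P N y" and Pscale: "P N (c *\<^sub>R x) = c *\<^sub>R P N x" for N x y c
    by (simp_all add: P_def inner_add_left scaleR_add_left sum.distrib scaleR_sum_right)
  have Pdiff: "P N (x - y) = P N x - P N y" for N x y
    by (simp add: P_def inner_diff_left scaleR_diff_left sum_subtractf)
  have span: "\<exists>N. \<forall>M\<ge>N. P M y = y" if "y \<in> span (range e)" for y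
    using that
  proof (induction rule: span_induct_alt)
    case base
    then show ?case by (simp add: P_def)
  next
    case (step c z y)
    then obtain n N where n: "z = e n" and N: "\<forall>M\<ge>N. P M y = y" by auto
    have "P M (e n) = e n" if "M \<ge> Suc n" for M
    proof -
      have "P M (e n) = (\<Sum>k<M. if k = n then e k else 0)"
        unfolding P_def by (intro sum.cong) (auto simp: hilbert_basis_inner)
      then show ?thesis using that by simp
    qed
    then have "\<forall>M\<ge>max N (Suc n). P M (c *\<^sub>R z + y) = c *\<^sub>R z + y"
      using N by (simp add: Padd Pscale n)
    then show ?case by blast
  qed
  have "(\<lambda>N. norm (x - P N x)) \<longlonglongrightarrow> 0"
  proof (rule LIMSEQ_I)
    fix r :: real assume "r > 0"
    have "x \<in> closure (span (range e))" using hb by (simp add: hilbert_basis_def)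
    then obtain y where y: "y \<in> span (range e)" "dist y x < r"
      using \<open>r > 0\<close> closure_approachable by blast
    obtain N where N: "\<forall>M\<ge>N. P M y = y" using span[OF y(1)] by blast
    have "norm (x - P M x) < r" if "M \<ge> N" for M
    proof -
      have "x - P M x = (x - y) - P M (x - y)" using N that by (simp add: Pdiff)
      then have "norm (x - P M x) \<le> norm (x - y)" using contr[of "x - y" M] by metis
      then show ?thesis using y(2) by (simp add: dist_norm norm_minus_commute)
    qed
    then show "\<exists>no. \<forall>n\<ge>no. norm (norm (x - P n x) - 0) < r" by auto
  qed
  then have "(\<lambda>N. x \<bullet> x - (norm (x - P N x))\<^sup>2) \<longlonglongrightarrow> x \<bullet> x - 0\<^sup>2"
    by (intro tendsto_intros)
  then show ?thesis unfolding sums_def by (simp add: res)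
qed

lemma lorentz_Q_eq: "lorentz_Q e x = 2 * (x \<bullet> e 0)\<^sup>2 - x \<bullet> x"
proof -
  have "(\<lambda>i. (x \<bullet> e (Suc i))\<^sup>2) sums (x \<bullet> x - (x \<bullet> e 0)\<^sup>2)"
    using hilbert_basis_parseval[of x] by (subst sums_Suc_iff) simp
  then show ?thesis by (simp add: lorentz_Q_def sums_unique[symmetric])
qed

lemma lorentz_form_eq: "lorentz_form e x y = 2 * (x \<bullet> e 0) * (y \<bullet> e 0) - x \<bullet> y"
  by (simp add: lorentz_form_def lorentz_Q_eq inner_add_left inner_add_right
      inner_commute[of y x] power2_eq_square field_simps)

lemma lorentz_Q_form: "lorentz_Q e x = lorentz_form e x x"
  by (simp add: lorentz_Q_eq lorentz_form_eq power2_eq_square)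

lemma lorentz_form_commute: "lorentz_form e x y = lorentz_form e y x"
  by (simp add: lorentz_form_eq inner_commute)

lemma lorentz_form_bilinear:
  "lorentz_form e (x + y) z = lorentz_form e x z + lorentz_form e y z"
  "lorentz_form e (x - y) z = lorentz_form e x z - lorentz_form e y z"
  "lorentz_form e (c *\<^sub>R x) z = c * lorentz_form e x z"
  "lorentz_form e z (x + y) = lorentz_form e z x + lorentz_form e z y"
  "lorentz_form e z (x - y) = lorentz_form e z x - lorentz_form e z y"
  "lorentz_form e z (c *\<^sub>R x) = c * lorentz_form e z x"
  by (simp_all add: lorentz_form_eq inner_add_left inner_add_right inner_diff_left
      inner_diff_right algebra_simps)

lemma spatial_cauchy_schwarz:
  "(x \<bullet> y - (x \<bullet> e 0) * (y \<bullet> e 0))\<^sup>2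
     \<le> (x \<bullet> x - (x \<bullet> e 0)\<^sup>2) * (y \<bullet> y - (y \<bullet> e 0)\<^sup>2)"
proof -
  define p where "p z = z - (z \<bullet> e 0) *\<^sub>R e 0" for z
  have "p z \<bullet> p w = z \<bullet> w - (z \<bullet> e 0) * (w \<bullet> e 0)" for z w
    by (simp add: p_def inner_diff_left inner_diff_right hilbert_basis_inner
        inner_commute[of "e 0"] algebra_simps)
  then show ?thesis using Cauchy_Schwarz_ineq[of "p x" "p y"] by (simp add: power2_eq_square)
qed

lemma spatial_nonneg: "x \<bullet> x - (x \<bullet> e 0)\<^sup>2 \<ge> 0"
  using Cauchy_Schwarz_ineq[of x "e 0"] by (simp add: hilbert_basis_inner)

lemma lorentz_orthogonal_nonpos:
  assumes y: "y \<in> hyp_space e" and w: "lorentz_form e w y = 0"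
  shows "lorentz_Q e w \<le> 0" and "lorentz_Q e w = 0 \<Longrightarrow> w = 0"
proof -
  define a where "a = w \<bullet> e 0"
  define b where "b = y \<bullet> e 0"
  define n where "n = w \<bullet> w - a\<^sup>2"
  have b: "b > 0" "y \<bullet> y = 2 * b\<^sup>2 - 1"
    using y by (auto simp: hyp_space_def lorentz_Q_eq b_def)
  have n0: "n \<ge> 0" using spatial_nonneg[of w] by (simp add: n_def a_def)
  have wy: "w \<bullet> y = 2 * a * b" using w by (simp add: lorentz_form_eq a_def b_def)
  have "(a * b)\<^sup>2 \<le> n * (b\<^sup>2 - 1)"
    using spatial_cauchy_schwarz[of w y] wy b by (simp add: a_def b_def n_def)
  then have *: "n + b\<^sup>2 * a\<^sup>2 \<le> b\<^sup>2 * n" by (simp add: algebra_simps power_mult_distrib)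
  then have "b\<^sup>2 * a\<^sup>2 \<le> b\<^sup>2 * n" using n0 by linarith
  then have "a\<^sup>2 \<le> n" using b(1) by simp
  then show "lorentz_Q e w \<le> 0" by (simp add: lorentz_Q_eq n_def a_def)
  assume "lorentz_Q e w = 0"
  then have "a\<^sup>2 = n" by (simp add: lorentz_Q_eq n_def a_def)
  then have "n = 0" "a\<^sup>2 = 0" using * n0 by auto
  then show "w = 0" by (simp add: n_def)
qed

lemma lorentz_orthogonal_cauchy_schwarz:
  assumes y: "y \<in> hyp_space e" and u: "lorentz_form e u y = 0" and v: "lorentz_form e v y = 0"
  shows "(lorentz_form e u v)\<^sup>2 \<le> lorentz_Q e u * lorentz_Q e v"
proof (cases "lorentz_Q e v = 0")
  case True
  then have "v = 0" using lorentz_orthogonal_nonpos(2)[OF y v] by simp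
  then show ?thesis by (simp add: lorentz_form_eq lorentz_Q_eq)
next
  case False
  then have neg: "lorentz_Q e v < 0" using lorentz_orthogonal_nonpos(1)[OF y v] by simp
  define b where "b = lorentz_form e u v"
  define q where "q = lorentz_Q e v"
  define t where "t = - b / q"
  have "lorentz_form e (u + t *\<^sub>R v) y = 0" by (simp add: lorentz_form_bilinear u v)
  then have "lorentz_Q e (u + t *\<^sub>R v) \<le> 0" by (rule lorentz_orthogonal_nonpos(1)[OF y])
  moreover have "lorentz_Q e (u + t *\<^sub>R v) = lorentz_Q e u + 2 * t * b + t\<^sup>2 * q"
    by (simp add: lorentz_Q_form lorentz_form_bilinear b_def q_def
        lorentz_form_commute[of v u] power2_eq_square algebra_simps)
  moreover have "2 * t * b + t\<^sup>2 * q = - b\<^sup>2 / q"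
    using neg by (simp add: t_def q_def power2_eq_square field_simps)
  ultimately have "lorentz_Q e u \<le> b\<^sup>2 / q" by simp
  then have "b\<^sup>2 \<le> lorentz_Q e u * q" using neg by (simp add: q_def neg_le_divide_eq)
  then show ?thesis by (simp add: b_def q_def)
qed

lemma lorentz_form_ge_1:
  assumes x: "x \<in> hyp_space e" and y: "y \<in> hyp_space e"
  shows "lorentz_form e x y \<ge> 1" and "lorentz_form e x y = 1 \<longleftrightarrow> x = y"
proof -
  define c where "c = lorentz_form e x y"
  define u where "u = x - c *\<^sub>R y"
  have Qy: "lorentz_form e y y = 1" and Qx: "lorentz_form e x x = 1"
    using x y by (auto simp: hyp_space_def lorentz_Q_form)
  have uy: "lorentz_form e u y = 0" by (simp add: u_def lorentz_form_bilinear Qy c_def)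
  have Qu: "lorentz_Q e u = 1 - c\<^sup>2"
    by (simp add: u_def lorentz_Q_form lorentz_form_bilinear Qx Qy
        lorentz_form_commute[of y x] power2_eq_square flip: c_def)
  have c2: "c\<^sup>2 \<ge> 1" using lorentz_orthogonal_nonpos(1)[OF y uy] Qu by simp
  define a where "a = x \<bullet> e 0"
  define b where "b = y \<bullet> e 0"
  have ab: "a > 0" "b > 0" "x \<bullet> x - a\<^sup>2 = a\<^sup>2 - 1" "y \<bullet> y - b\<^sup>2 = b\<^sup>2 - 1"
    using x y by (auto simp: hyp_space_def lorentz_Q_eq a_def b_def)
  have "(x \<bullet> y - a * b)\<^sup>2 \<le> (a\<^sup>2 - 1) * (b\<^sup>2 - 1)"
    using spatial_cauchy_schwarz[of x y] ab(3,4) unfolding a_def b_def by simp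
  also have "\<dots> \<le> a\<^sup>2 * b\<^sup>2"
    using spatial_nonneg[of x] spatial_nonneg[of y] ab(3,4)
    by (intro mult_mono) (auto simp: a_def b_def)
  finally have fin: "(x \<bullet> y - a * b)\<^sup>2 \<le> (a * b)\<^sup>2" by (simp only: power_mult_distrib)
  have "0 \<le> a * b" using ab(1,2) by simp
  with fin have "x \<bullet> y - a * b \<le> a * b" by (rule power2_le_imp_le)
  then have "c \<ge> 0" by (simp add: c_def lorentz_form_eq a_def b_def)
  then show "lorentz_form e x y \<ge> 1" using c2 power2_le_imp_le[of 1 c] by (simp add: c_def)
  show "lorentz_form e x y = 1 \<longleftrightarrow> x = y"
  proof
    assume "lorentz_form e x y = 1"
    then have "c = 1" by (simp add: c_def)
    then have "u = 0" using lorentz_orthogonal_nonpos(2)[OF y uy] Qu by simp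
    then show "x = y" by (simp add: u_def \<open>c = 1\<close>)
  qed (simp add: Qy)
qed

lemma cosh_hyp_dist:
  assumes "x \<in> hyp_space e" "y \<in> hyp_space e"
  shows "cosh (hyp_dist e x y) = lorentz_form e x y" and "hyp_dist e x y \<ge> 0"
  using lorentz_form_ge_1(1)[OF assms] assms by (simp_all add: hyp_dist_def)

lemma Metric_space_hyp: "Metric_space (hyp_space e) (hyp_dist e)"
proof -
  define S where "S = hyp_space e"
  define d :: "'a \<Rightarrow> 'a \<Rightarrow> real" where "d x y = hyp_dist e x y" for x y
  have comm: "d x y = d y x" for x y by (simp add: d_def hyp_dist_def lorentz_form_commute)
  have zero: "d x y = 0 \<longleftrightarrow> x = y" if "x \<in> S" "y \<in> S" for x y
    using lorentz_form_ge_1[of x y] that cosh_hyp_dist[of x y]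
    by (auto simp: S_def d_def hyp_dist_def arcosh_1)
  have tri: "d x z \<le> d x y + d y z" if x: "x \<in> S" and y: "y \<in> S" and z: "z \<in> S" for x y z
  proof -
    note x = x[unfolded S_def] and y = y[unfolded S_def] and z = z[unfolded S_def]
    define p where "p = lorentz_form e x y"
    define q where "q = lorentz_form e y z"
    define u where "u = x - p *\<^sub>R y"
    define v where "v = z - q *\<^sub>R y"
    have Q: "lorentz_form e x x = 1" "lorentz_form e y y = 1" "lorentz_form e z z = 1"
      using x y z by (auto simp: hyp_space_def lorentz_Q_form)
    have cp: "cosh (d x y) = p" "d x y \<ge> 0" "cosh (d y z) = q" "d y z \<ge> 0"
      "cosh (d x z) = lorentz_form e x z" "d x z \<ge> 0"
      using x y z by (simp_all add: cosh_hyp_dist d_def p_def q_def)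
    have u: "lorentz_form e u y = 0" "lorentz_Q e u = 1 - p\<^sup>2"
      by (simp_all add: u_def lorentz_Q_form lorentz_form_bilinear Q
        lorentz_form_commute[of y x] power2_eq_square flip: p_def)
    have v: "lorentz_form e v y = 0" "lorentz_Q e v = 1 - q\<^sup>2"
      by (simp_all add: v_def lorentz_Q_form lorentz_form_bilinear Q
        lorentz_form_commute[of z y] power2_eq_square flip: q_def)
    have uv: "lorentz_form e u v = lorentz_form e x z - p * q"
      by (simp add: u_def v_def lorentz_form_bilinear Q algebra_simps flip: p_def q_def)
    have sinh2: "(sinh t)\<^sup>2 = (cosh t)\<^sup>2 - 1" for t :: real
      by (simp add: cosh_square_eq)
    have "(lorentz_form e x z - p * q)\<^sup>2 \<le> (1 - p\<^sup>2) * (1 - q\<^sup>2)"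
      using lorentz_orthogonal_cauchy_schwarz[OF y u(1) v(1)] by (simp add: uv u v)
    also have "\<dots> = (sinh (d x y) * sinh (d y z))\<^sup>2"
      unfolding power_mult_distrib sinh2 cp(1,3) by (simp add: algebra_simps)
    finally have fin: "(lorentz_form e x z - p * q)\<^sup>2 \<le> (sinh (d x y) * sinh (d y z))\<^sup>2" .
    have "0 \<le> sinh (d x y) * sinh (d y z)" using cp(2,4) by simp
    with fin have "lorentz_form e x z - p * q \<le> sinh (d x y) * sinh (d y z)"
      by (rule power2_le_imp_le)
    then have "cosh (d x z) \<le> cosh (d x y + d y z)"
      unfolding cosh_add cp(1,3,5) by linarith
    then show ?thesis using cp(2,4,6) by (simp add: cosh_real_nonneg_le_iff)
  qed
  have "d x y \<ge> 0" for x y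
    using lorentz_form_ge_1(1)[of x y] by (simp add: d_def hyp_dist_def)
  then have "Metric_space S d"
    by unfold_locales (use comm zero tri in auto)
  then show ?thesis by (simp add: S_def d_def[abs_def])
qed

lemma topspace_Isom_topology: "topspace (Isom_topology e) = carrier (Isom e)"
proof -
  interpret Metric_space "hyp_space e" "hyp_dist e" by (rule Metric_space_hyp)
  have "carrier (Isom e) \<subseteq> (\<Pi>\<^sub>E x\<in>hyp_space e. hyp_space e)"
    by (auto simp: Isom_def hyp_isometries_def Bij_def bij_betw_def PiE_def)
  then show ?thesis by (simp add: Isom_topology_def Int_absorb1)
qed

end

lemma subgroup_hyp_isometries: "subgroup (hyp_isometries e) (BijGroup (hyp_space e))"
proof -
  let ?S = "hyp_space e"
  have "restrict (inv_into ?S g) ?S \<in> hyp_isometries e" if g: "g \<in> hyp_isometries e" for g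
  proof -
    have b: "g \<in> Bij ?S" "g ` ?S = ?S"
      using g by (auto simp: hyp_isometries_def Bij_def bij_betw_def)
    have "hyp_dist e (inv_into ?S g x) (inv_into ?S g y) = hyp_dist e x y"
      if "x \<in> ?S" "y \<in> ?S" for x y
      using g that b f_inv_into_f[of _ g ?S] inv_into_into[of _ g ?S]
      unfolding hyp_isometries_def by (smt (verit) mem_Collect_eq)
    then show ?thesis using b(1) by (simp add: hyp_isometries_def restrict_inv_into_Bij)
  qed
  moreover have "compose ?S g h \<in> hyp_isometries e"
    if "g \<in> hyp_isometries e" "h \<in> hyp_isometries e" for g h
  proof -
    have "h x \<in> ?S" if "x \<in> ?S" for x
      using \<open>h \<in> hyp_isometries e\<close> that Bij_imp_funcset unfolding hyp_isometries_def by blast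
    then show ?thesis using that by (simp add: hyp_isometries_def compose_Bij compose_eq)
  qed
  ultimately show ?thesis
    by (intro subgroup.intro)
      (auto simp: hyp_isometries_def BijGroup_def id_Bij inv_BijGroup[unfolded BijGroup_def])
qed

lemma group_Isom: "group (Isom e)"
  unfolding Isom_def by (rule subgroup.subgroup_is_group[OF subgroup_hyp_isometries group_BijGroup])

end

(* Two nonempty open conjugation-invariant sets of isometries are disjoint: the isometries g that
   move some point y by little, and those for which (x, g^2 x) is much larger than (x, g x) for some
   point x, such as the transvections of large translation length.  Disjointness is Gromov
   hyperbolicity, in the multiplicative form
     (x,z) (w,y) <= 2 ((x,w) (z,y) + (w,z) (x,y)),
   applied to w = g x and z = g^2 x: these lie about as far from an almost fixed point y as x does,
   so that (x, g^2 x) is at most a constant times (x, g x). *)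

theory Submission
  imports Defs
begin

context
  fixes e :: "nat \<Rightarrow> 'a::{real_inner,complete_space}"
  assumes hb: "hilbert_basis e"
begin

section \<open>Inequalities for the Lorentz form on the hyperboloid\<close>

lemma lorentz_form_self: "x \<in> hyp_space e \<Longrightarrow> lorentz_form e x x = 1"
  using lorentz_form_ge_1(2)[OF hb, of x x] by simp

lemma lorentz_form_pos: "\<lbrakk>x \<in> hyp_space e; y \<in> hyp_space e\<rbrakk> \<Longrightarrow> lorentz_form e x y > 0"
  using lorentz_form_ge_1(1)[OF hb, of x y] by simp

text \<open>Exponential form of the triangle inequality: since sinh stays below cosh,
  \<open>cosh (a + b) \<le> 2 * cosh a * cosh b\<close>.\<close>

lemma lorentz_form_triangle:
  assumes "x \<in> hyp_space e" "y \<in> hyp_space e" "z \<in> hyp_space e"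
  shows "lorentz_form e x z \<le> 2 * lorentz_form e x y * lorentz_form e y z"
proof -
  interpret Metric_space "hyp_space e" "hyp_dist e" by (rule Metric_space_hyp[OF hb])
  let ?a = "hyp_dist e x y" and ?b = "hyp_dist e y z"
  have "cosh (hyp_dist e x z) \<le> cosh (?a + ?b)"
    using triangle[OF assms] by (subst cosh_real_nonneg_le_iff) auto
  also have "\<dots> \<le> cosh ?a * cosh ?b + cosh ?a * cosh ?b"
    unfolding cosh_add
    by (intro add_left_mono mult_mono) (auto simp: less_imp_le[OF sinh_less_cosh_real])
  finally show ?thesis using assms by (simp add: cosh_hyp_dist(1)[OF hb])
qed

text \<open>After rescaling \<open>x\<close>, \<open>w\<close>, \<open>z\<close> to have product \<open>1\<close> with \<open>y\<close>, the vector
  \<open>x - 2 w + z\<close> is orthogonal to \<open>y\<close>, so that \<open>Q\<close> is nonpositive on it.\<close>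

lemma lorentz_form_four_point:
  assumes x: "x \<in> hyp_space e" and w: "w \<in> hyp_space e"
    and z: "z \<in> hyp_space e" and y: "y \<in> hyp_space e"
  shows "lorentz_form e x z * lorentz_form e w y
    \<le> 2 * (lorentz_form e x w * lorentz_form e z y + lorentz_form e w z * lorentz_form e x y)"
proof -
  let ?B = "lorentz_form e"
  define p q r where "p = ?B x y" and "q = ?B w y" and "r = ?B z y"
  have pos: "p > 0" "q > 0" "r > 0" using assms by (simp_all add: p_def q_def r_def lorentz_form_pos)
  define v where "v = (1/p) *\<^sub>R x - (2/q) *\<^sub>R w + (1/r) *\<^sub>R z"
  note bil = lorentz_form_bilinear[OF hb]
  have "?B v y = 0" using pos by (simp add: v_def bil flip: p_def q_def r_def)
  then have "?B v v \<le> 0" using lorentz_orthogonal_nonpos(1)[OF hb y] by (simp add: lorentz_Q_form[OF hb])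
  moreover have "?B v v = 1/p\<^sup>2 + 4/q\<^sup>2 + 1/r\<^sup>2 + 2 * ?B x z / (p*r) - 4 * ?B x w / (p*q)
      - 4 * ?B w z / (q*r)"
    by (simp add: v_def bil lorentz_form_self assms lorentz_form_commute[OF hb, of w x]
        lorentz_form_commute[OF hb, of z x] lorentz_form_commute[OF hb, of z w]
        power2_eq_square algebra_simps add_divide_distrib diff_divide_distrib)
  \<comment> \<open>These terms come from \<open>Q = 1\<close> at the three points; dropping them
    leaves the mixed terms.\<close>
  moreover have "1/p\<^sup>2 \<ge> 0" "4/q\<^sup>2 \<ge> 0" "1/r\<^sup>2 \<ge> 0" by auto
  ultimately have "?B x z / (p*r) \<le> 2 * ?B x w / (p*q) + 2 * ?B w z / (q*r)" by linarith
  then have "?B x z / (p*r) * (p*q*r) \<le> (2 * ?B x w / (p*q) + 2 * ?B w z / (q*r)) * (p*q*r)"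
    using pos by (intro mult_right_mono) auto
  also have "?B x z / (p*r) * (p*q*r) = ?B x z * q" using pos by simp
  also have "(2 * ?B x w / (p*q) + 2 * ?B w z / (q*r)) * (p*q*r)
      = 2 * (?B x w * r + ?B w z * p)"
    using pos by (simp add: distrib_right)
  finally show ?thesis by (simp add: p_def q_def r_def)
qed

section \<open>Displacement of an isometry and of its square\<close>

lemma hyp_isometriesD:
  assumes "g \<in> hyp_isometries e" "x \<in> hyp_space e"
  shows "g x \<in> hyp_space e"
    and "y \<in> hyp_space e \<Longrightarrow> lorentz_form e (g x) (g y) = lorentz_form e x y"
proof -
  have mem: "g z \<in> hyp_space e" if "z \<in> hyp_space e" for z
    using assms(1) that Bij_imp_funcset unfolding hyp_isometries_def by blast
  show "g x \<in> hyp_space e" by (rule mem[OF assms(2)])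
  assume "y \<in> hyp_space e"
  moreover from this have "hyp_dist e (g x) (g y) = hyp_dist e x y"
    using assms by (simp add: hyp_isometries_def)
  ultimately show "lorentz_form e (g x) (g y) = lorentz_form e x y"
    using mem assms(2) by (metis cosh_hyp_dist(1)[OF hb])
qed

text \<open>The forms of \<open>x\<close> and of \<open>g (g x)\<close> with \<open>y\<close> are at
  most \<open>2 * K\<close> times that of \<open>g x\<close>, so this last factor cancels from the
  four-point inequality.\<close>

lemma square_displacement_le:
  assumes g: "g \<in> hyp_isometries e" and x: "x \<in> hyp_space e" and y: "y \<in> hyp_space e"
    and le: "lorentz_form e (g y) y \<le> K"
  shows "lorentz_form e x (g (g x)) \<le> 8 * K * lorentz_form e x (g x)"
proof -
  let ?B = "lorentz_form e"
  note D = hyp_isometriesD[OF g]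
  have mem: "g x \<in> hyp_space e" "g (g x) \<in> hyp_space e" "g y \<in> hyp_space e"
    using D x y by auto
  define a where "a = ?B x (g x)"
  define b where "b = ?B (g x) y"
  have pos: "a > 0" "b > 0" using x y mem by (simp_all add: a_def b_def lorentz_form_pos)
  have "?B x y \<le> 2 * b * ?B y (g y)"
    using lorentz_form_triangle[OF mem(1) y mem(3)] D(2)[OF x y] by (simp add: b_def)
  also have "\<dots> \<le> 2 * b * K"
    using le pos by (intro mult_left_mono) (auto simp: lorentz_form_commute[OF hb, of y])
  finally have 1: "?B x y \<le> 2 * b * K" .
  have "?B (g (g x)) y \<le> 2 * b * ?B (g y) y"
    using lorentz_form_triangle[OF mem(2) mem(3) y] D(2)[OF mem(1) y] by (simp add: b_def)
  also have "\<dots> \<le> 2 * b * K" using le pos by (intro mult_left_mono) auto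
  finally have 2: "?B (g (g x)) y \<le> 2 * b * K" .
  have "?B x (g (g x)) * b \<le> 2 * (a * ?B (g (g x)) y + a * ?B x y)"
    using lorentz_form_four_point[OF x mem(1,2) y] D(2)[OF x mem(1)] by (simp add: a_def b_def)
  also have "\<dots> \<le> 2 * (a * (2 * b * K) + a * (2 * b * K))"
    using 1 2 pos by (intro mult_left_mono add_mono) auto
  also have "\<dots> = 8 * K * a * b" by simp
  finally show ?thesis using pos by (simp add: a_def)
qed

section \<open>Boosts along a geodesic through \<open>e 0\<close>\<close>

text \<open>The hyperbolic rotation with parameter \<open>t\<close> in the plane of
  \<open>e 0\<close> and \<open>e 1\<close>, written as the identity plus a correction in that
  plane, so that it visibly fixes the orthogonal complement.\<close>

definition boost :: "real \<Rightarrow> 'a \<Rightarrow> 'a" where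
  "boost t x = x + ((cosh t - 1) * (x \<bullet> e 0) + sinh t * (x \<bullet> e 1)) *\<^sub>R e 0
     + (sinh t * (x \<bullet> e 0) + (cosh t - 1) * (x \<bullet> e 1)) *\<^sub>R e 1"

lemma boost_inner:
  "boost t x \<bullet> e 0 = cosh t * (x \<bullet> e 0) + sinh t * (x \<bullet> e 1)"
  "boost t x \<bullet> e 1 = sinh t * (x \<bullet> e 0) + cosh t * (x \<bullet> e 1)"
  by (simp_all add: boost_def inner_add_left hilbert_basis_inner[OF hb] algebra_simps)

lemma boost_add: "boost s (boost t x) = boost (s + t) x"
proof -
  define a b where "a = x \<bullet> e 0" and "b = x \<bullet> e 1"
  show ?thesis
    unfolding boost_def[of s] boost_inner
    unfolding boost_def cosh_add sinh_add a_def[symmetric] b_def[symmetric]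
    by (simp add: algebra_simps)
qed

lemma boost_0: "boost 0 x = x"
  by (simp add: boost_def)

lemma lorentz_form_boost: "lorentz_form e (boost t x) (boost t y) = lorentz_form e x y"
proof -
  define a b a' b' where "a = x \<bullet> e 0" and "b = x \<bullet> e 1" and "a' = y \<bullet> e 0" and "b' = y \<bullet> e 1"
  note ab = this
  have cs: "cosh t * cosh t = 1 + sinh t * sinh t"
    using cosh_square_eq[of t] by (simp add: power2_eq_square)
  have "boost t x \<bullet> boost t y = x \<bullet> boost t y
      + ((cosh t - 1) * a + sinh t * b) * (cosh t * a' + sinh t * b')
      + (sinh t * a + (cosh t - 1) * b) * (sinh t * a' + cosh t * b')"
    by (subst boost_def) (simp add: inner_add_left inner_commute[of "e _"] boost_inner flip: ab
        del: One_nat_def)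
  also have "x \<bullet> boost t y = x \<bullet> y + ((cosh t - 1) * a' + sinh t * b') * a
      + (sinh t * a' + (cosh t - 1) * b') * b"
    by (simp add: boost_def inner_add_right flip: ab del: One_nat_def)
  finally show ?thesis
    unfolding lorentz_form_eq[OF hb] boost_inner ab[symmetric]
    using cs by algebra
qed

lemma basis_mem_hyp_space: "e 0 \<in> hyp_space e"
  by (simp add: hyp_space_def lorentz_Q_eq[OF hb] hilbert_basis_inner[OF hb])

lemma boost_mem_hyp_space:
  assumes "x \<in> hyp_space e"
  shows "boost t x \<in> hyp_space e"
proof -
  define a b where "a = x \<bullet> e 0" and "b = x \<bullet> e 1"
  have a: "a > 0" and Q: "x \<bullet> x = 2 * a\<^sup>2 - 1"
    using assms by (auto simp: a_def hyp_space_def lorentz_Q_eq[OF hb])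
  \<comment> \<open>The \<open>e 1\<close> coordinate is dominated by the \<open>e 0\<close>
    coordinate, which keeps the boosted point on the upper sheet.\<close>
  have "b\<^sup>2 \<le> x \<bullet> x - a\<^sup>2"
    using spatial_cauchy_schwarz[OF hb, of x "e 1"]
    by (simp add: a_def b_def hilbert_basis_inner[OF hb])
  with Q have "b\<^sup>2 \<le> a\<^sup>2" by simp
  with a have ba: "\<bar>b\<bar> \<le> a" by (simp add: abs_le_square_iff[symmetric])
  have "\<bar>sinh t * b\<bar> \<le> \<bar>sinh t\<bar> * a" using ba by (simp add: abs_mult mult_left_mono)
  also have "\<dots> < cosh t * a"
    using a sinh_less_cosh_real[of "\<bar>t\<bar>"] by (intro mult_strict_right_mono) auto
  finally have "boost t x \<bullet> e 0 > 0" by (simp add: boost_inner a_def b_def)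
  moreover have "lorentz_Q e (boost t x) = 1"
    using assms by (simp add: hyp_space_def lorentz_Q_form[OF hb] lorentz_form_boost)
  ultimately show ?thesis by (simp add: hyp_space_def)
qed

lemma boost_mem_hyp_isometries: "restrict (boost t) (hyp_space e) \<in> hyp_isometries e"
proof -
  have "bij_betw (boost t) (hyp_space e) (hyp_space e)"
    by (rule bij_betwI[where g = "boost (-t)"])
      (auto simp: boost_mem_hyp_space boost_add boost_0)
  then have "restrict (boost t) (hyp_space e) \<in> Bij (hyp_space e)"
    by (simp add: Bij_def)
  then show ?thesis
    by (simp add: hyp_isometries_def hyp_dist_def boost_mem_hyp_space lorentz_form_boost)
qed

lemma lorentz_form_boost_basis: "lorentz_form e (e 0) (boost t (e 0)) = cosh t"
  by (simp add: lorentz_form_eq[OF hb] boost_inner[of t "e 0"] inner_commute[of "e 0" "boost _ _"]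
      hilbert_basis_inner[OF hb] del: One_nat_def)

section \<open>Open sets and conjugacy in the isometry group\<close>

text \<open>Preimage of the open ball of radius \<open>r\<close> about \<open>p\<close> under
  evaluation at \<open>x\<close>, which is continuous for pointwise convergence.\<close>

lemma openin_Isom_topology_eval:
  assumes x: "x \<in> hyp_space e" and p: "p \<in> hyp_space e" and r: "r \<ge> 0"
  shows "openin (Isom_topology e) {f \<in> hyp_isometries e. lorentz_form e p (f x) < cosh r}"
proof -
  interpret Metric_space "hyp_space e" "hyp_dist e" by (rule Metric_space_hyp[OF hb])
  let ?P = "product_topology (\<lambda>_. mtopology) (hyp_space e)"
  have "lorentz_form e p (f x) < cosh r \<longleftrightarrow> f x \<in> mball p r" if "f \<in> hyp_isometries e" for f
    using hyp_isometriesD(1)[OF that x] p r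
    by (simp add: in_mball cosh_real_nonneg_less_iff flip: cosh_hyp_dist(1)[OF hb])
  moreover have "f \<in> topspace (Isom_topology e) \<longleftrightarrow> f \<in> hyp_isometries e" for f
    by (simp add: topspace_Isom_topology[OF hb] Isom_def)
  ultimately have eq: "{f \<in> hyp_isometries e. lorentz_form e p (f x) < cosh r}
      = {f \<in> topspace (Isom_topology e). f x \<in> mball p r}"
    by blast
  have "continuous_map (Isom_topology e) mtopology (\<lambda>f. f x)"
    unfolding Isom_topology_def
    by (intro continuous_map_from_subtopology continuous_map_product_projection x)
  then show ?thesis unfolding eq by (rule openin_continuous_map_preimage) simp
qed

text \<open>Products in the group are restricted compositions, so conjugation by \<open>h\<close>,
  with inverse \<open>k\<close>, unfolds to equations at points of the space.\<close>

lemma conjugate_apply: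
  assumes g: "g \<in> hyp_isometries e" and f: "f \<in> conjugacy_class (Isom e) g"
  obtains h k where "h \<in> hyp_isometries e" "k \<in> hyp_isometries e"
    "\<And>x. x \<in> hyp_space e \<Longrightarrow> f x = h (g (k x))"
    "\<And>x. x \<in> hyp_space e \<Longrightarrow> h (k x) = x" "\<And>x. x \<in> hyp_space e \<Longrightarrow> k (h x) = x"
proof -
  interpret G: group "Isom e" by (rule group_Isom)
  have car: "carrier (Isom e) = hyp_isometries e" by (simp add: Isom_def)
  have mult: "(a \<otimes>\<^bsub>Isom e\<^esub> b) x = a (b x)"
    if "a \<in> hyp_isometries e" "b \<in> hyp_isometries e" "x \<in> hyp_space e" for a b x
    using that by (simp add: Isom_def BijGroup_def hyp_isometries_def compose_eq)
  have one: "\<one>\<^bsub>Isom e\<^esub> x = x" if "x \<in> hyp_space e" for x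
    using that by (simp add: Isom_def BijGroup_def)
  obtain h where h: "h \<in> carrier (Isom e)"
    and fh: "f = h \<otimes>\<^bsub>Isom e\<^esub> g \<otimes>\<^bsub>Isom e\<^esub> inv\<^bsub>Isom e\<^esub> h"
    using f by (auto simp: conjugacy_class_def)
  define k where "k = inv\<^bsub>Isom e\<^esub> h"
  have k: "k \<in> carrier (Isom e)" using h by (simp add: k_def)
  have hk: "h \<otimes>\<^bsub>Isom e\<^esub> k = \<one>\<^bsub>Isom e\<^esub>" "k \<otimes>\<^bsub>Isom e\<^esub> h = \<one>\<^bsub>Isom e\<^esub>"
    using h by (simp_all add: k_def)
  have hg: "h \<otimes>\<^bsub>Isom e\<^esub> g \<in> carrier (Isom e)" using h g car G.m_closed by blast
  show ?thesis
  proof (rule that[of h k])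
    fix x assume x: "x \<in> hyp_space e"
    show "f x = h (g (k x))"
      using x h k g hg car hyp_isometriesD(1)[of k x] by (simp add: fh mult flip: k_def)
    show "h (k x) = x" using x h k car mult[of h k x] by (simp add: hk one)
    show "k (h x) = x" using x h k car mult[of k h x] by (simp add: hk one)
  qed (use h k car in auto)
qed

text \<open>The conjugate by \<open>h\<close> displaces \<open>h y\<close> exactly as far as
  \<open>g\<close> displaces \<open>y\<close>.\<close>

lemma almost_fixed_point_conjugate:
  assumes g: "g \<in> hyp_isometries e" and f: "f \<in> conjugacy_class (Isom e) g"
  shows "(\<exists>y\<in>hyp_space e. lorentz_form e (f y) y \<le> K)
    \<longleftrightarrow> (\<exists>y\<in>hyp_space e. lorentz_form e (g y) y \<le> K)"
proof -
  obtain h k where h: "h \<in> hyp_isometries e" and k: "k \<in> hyp_isometries e"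
    and fx: "\<And>x. x \<in> hyp_space e \<Longrightarrow> f x = h (g (k x))"
    and hk: "\<And>x. x \<in> hyp_space e \<Longrightarrow> h (k x) = x" "\<And>x. x \<in> hyp_space e \<Longrightarrow> k (h x) = x"
    using conjugate_apply[OF g f] by metis
  note mem = hyp_isometriesD(1)[OF g] hyp_isometriesD(1)[OF h] hyp_isometriesD(1)[OF k]
  have *: "lorentz_form e (f (h y)) (h y) = lorentz_form e (g y) y" if "y \<in> hyp_space e" for y
    using that by (simp add: fx hk mem hyp_isometriesD(2)[OF h])
  have "lorentz_form e (f y) y = lorentz_form e (g (k y)) (k y)" if "y \<in> hyp_space e" for y
    using *[of "k y"] that by (simp add: hk mem)
  with * show ?thesis using mem by metis
qed

section \<open>Separation of long boosts from isometries with an almost fixed point\<close>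

text \<open>The assumptions \<open>f1\<close> and \<open>f2\<close> define a neighbourhood of \<open>\<tau>\<close>, and they let \<open>f\<^sup>2\<close> be
  compared with \<open>\<tau>\<^sup>2\<close> at \<open>e 0\<close> without continuity of composition; \<open>1000\<close> is not optimal.\<close>

lemma near_boost_no_almost_fixed_point:
  fixes t :: real
  defines "\<tau> \<equiv> boost t"
  assumes f: "f \<in> hyp_isometries e" and y: "y \<in> hyp_space e" "lorentz_form e (f y) y \<le> 2"
    and f1: "lorentz_form e (\<tau> (e 0)) (f (e 0)) < 2"
    and f2: "lorentz_form e (\<tau> (\<tau> (e 0))) (f (\<tau> (e 0))) < 2"
  shows "cosh t < 1000"
proof -
  let ?B = "lorentz_form e"
  note D = hyp_isometriesD[OF f]
  define x where "x = e 0"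
  define c where "c = cosh t"
  define X where "X = ?B x (f (f x))"
  have mem: "x \<in> hyp_space e" "\<tau> x \<in> hyp_space e" "\<tau> (\<tau> x) \<in> hyp_space e"
    "f x \<in> hyp_space e" "f (f x) \<in> hyp_space e" "f (\<tau> x) \<in> hyp_space e"
    by (simp_all add: x_def \<tau>_def D boost_mem_hyp_space basis_mem_hyp_space)
  have c: "c \<ge> 1" by (simp add: c_def cosh_real_ge_1)
  have X: "X > 0" using mem by (simp add: X_def lorentz_form_pos)
  have x\<tau>: "?B x (\<tau> x) = c" by (simp add: x_def \<tau>_def c_def lorentz_form_boost_basis)
  have "?B x (\<tau> (\<tau> x)) = cosh (2 * t)"
    using lorentz_form_boost_basis[of "2 * t"] by (simp add: x_def \<tau>_def boost_add)
  then have x\<tau>\<tau>: "?B x (\<tau> (\<tau> x)) = 2 * c\<^sup>2 - 1" by (simp add: c_def cosh_double_cosh)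
  have "?B x (f x) \<le> 2 * c * ?B (\<tau> x) (f x)"
    using lorentz_form_triangle[OF mem(1,2,4)] by (simp add: x\<tau>)
  also have "\<dots> \<le> 2 * c * 2" using f1 c by (intro mult_left_mono) (auto simp: x_def)
  \<comment> \<open>Here \<open>K = 2\<close>, and \<open>64 * c\<close> is
    \<open>8 * 2 * (4 * c)\<close>.\<close>
  finally have "X \<le> 64 * c" using square_displacement_le[OF f mem(1) y] by (simp add: X_def)
  moreover have "2 * c\<^sup>2 - 1 \<le> 16 * X"
  proof -
    \<comment> \<open>The passage from \<open>f (f x)\<close> to \<open>\<tau> (\<tau> x)\<close>
      goes through \<open>f (\<tau> x)\<close>: the first leg is the image under \<open>f\<close> of
      the one bounded by \<open>f1\<close>, the second is bounded by \<open>f2\<close>.\<close>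
    have "?B (f (f x)) (f (\<tau> x)) = ?B (\<tau> x) (f x)"
      using D(2)[OF mem(4,2)] by (simp add: lorentz_form_commute[OF hb, of "f x"])
    then have "?B (f (f x)) (\<tau> (\<tau> x)) \<le> 2 * ?B (\<tau> x) (f x) * ?B (\<tau> (\<tau> x)) (f (\<tau> x))"
      using lorentz_form_triangle[OF mem(5,6,3)] by (simp add: lorentz_form_commute[OF hb, of "f (\<tau> x)"])
    also have "\<dots> \<le> 2 * 2 * 2"
      using f1 f2 lorentz_form_pos[OF mem(3,6)] lorentz_form_pos[OF mem(2,4)]
      by (intro mult_mono) (auto simp: x_def)
    finally have "2 * X * ?B (f (f x)) (\<tau> (\<tau> x)) \<le> 2 * X * 8"
      using X by (intro mult_left_mono) auto
    then show ?thesis using lorentz_form_triangle[OF mem(1,5,3)] by (simp add: x\<tau>\<tau> X_def)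
  qed
  \<comment> \<open>A quadratic lower bound meets a linear upper bound; \<open>c \<ge> 1000\<close>
    would give \<open>976 * c \<le> 1\<close>.\<close>
  ultimately have "2 * c * c - 1 \<le> 1024 * c" by (simp add: power2_eq_square)
  moreover have "2 * 1000 * c \<le> 2 * c * c" if "c \<ge> 1000"
    using that c by (intro mult_right_mono) auto
  ultimately show ?thesis using c by (fold c_def) linarith
qed

end

theorem theorem1p9:
  fixes e :: "nat \<Rightarrow> 'a::{real_inner,complete_space}"
  assumes "hilbert_basis e"
  shows "\<not> (\<exists>g \<in> carrier (Isom e).
           Isom_topology e closure_of conjugacy_class (Isom e) g = topspace (Isom_topology e))"
proof
  note hb = assms
  let ?H = "hyp_space e" and ?B = "lorentz_form e"
  \<comment> \<open>Chosen so that \<open>cosh t\<close> is exactly the excluded value 1000.\<close>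
  define t :: real where "t = arcosh 1000"
  define r :: real where "r = arcosh 2"
  let ?\<tau> = "boost e t" and ?T = "\<lambda>t. restrict (boost e t) (hyp_space e)"
  define U where "U x p = {f \<in> hyp_isometries e. ?B p (f x) < 2}" for x p
  have r: "r \<ge> 0" "cosh r = 2" by (simp_all add: r_def)
  have openU: "openin (Isom_topology e) (U x p)" if "x \<in> ?H" "p \<in> ?H" for x p
    using openin_Isom_topology_eval[OF hb that r(1)] by (simp add: U_def r)
  note mem = basis_mem_hyp_space[OF hb] boost_mem_hyp_space[OF hb basis_mem_hyp_space[OF hb], of t]
  note mem' = boost_mem_hyp_space[OF hb mem(2), of t]
  assume "\<exists>g \<in> carrier (Isom e).
           Isom_topology e closure_of conjugacy_class (Isom e) g = topspace (Isom_topology e)"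
  then obtain g where g: "g \<in> hyp_isometries e"
    and dense: "Isom_topology e closure_of conjugacy_class (Isom e) g = hyp_isometries e"
    by (auto simp: topspace_Isom_topology[OF hb] Isom_def)
  have meets: "\<exists>f\<in>conjugacy_class (Isom e) g. f \<in> W"
    if "openin (Isom_topology e) W" "?T s \<in> W" for W s
    using boost_mem_hyp_isometries[OF hb, of s] that unfolding dense[symmetric] in_closure_of
    by blast
  \<comment> \<open>Density near the identity: some conjugate of \<open>g\<close> almost fixes
    \<open>e 0\<close>, hence \<open>g\<close> almost fixes some point.\<close>
  have "?T 0 \<in> U (e 0) (e 0)"
    using mem(1) boost_mem_hyp_isometries[OF hb, of 0]
    by (simp add: U_def boost_0[OF hb] lorentz_form_self[OF hb])
  then obtain f where f: "f \<in> conjugacy_class (Isom e) g" "?B (e 0) (f (e 0)) < 2"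
    using meets[OF openU[OF mem(1,1)]] by (auto simp: U_def)
  then have "\<exists>y\<in>?H. ?B (f y) y \<le> 2"
    using mem(1) by (auto intro!: bexI[of _ "e 0"] simp: lorentz_form_commute[OF hb, of "f _"])
  then have fixg: "\<exists>y\<in>?H. ?B (g y) y \<le> 2"
    using almost_fixed_point_conjugate[OF hb g f(1)] by blast
  \<comment> \<open>Density near the long boost: some conjugate \<open>f'\<close> lies in this
    neighbourhood, yet inherits an almost fixed point from \<open>g\<close>.\<close>
  have "?T t \<in> U (e 0) (?\<tau> (e 0)) \<inter> U (?\<tau> (e 0)) (?\<tau> (?\<tau> (e 0)))"
    using mem mem' boost_mem_hyp_isometries[OF hb, of t]
    by (simp add: U_def lorentz_form_self[OF hb])
  then obtain f' where f': "f' \<in> conjugacy_class (Isom e) g" "f' \<in> hyp_isometries e"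
    "?B (?\<tau> (e 0)) (f' (e 0)) < 2" "?B (?\<tau> (?\<tau> (e 0))) (f' (?\<tau> (e 0))) < 2"
    using meets[OF openin_Int[OF openU[OF mem] openU[OF mem(2) mem']]] by (auto simp: U_def)
  obtain y where "y \<in> ?H" "?B (f' y) y \<le> 2"
    using fixg almost_fixed_point_conjugate[OF hb g f'(1)] by blast
  then have "cosh t < 1000"
    using near_boost_no_almost_fixed_point[OF hb f'(2) _ _ f'(3,4)] by blast
  then show False by (simp add: t_def)
qed

end
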